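(* Let $(\mathfrak g,\pi)$ and $(\mathfrak h,\mu)$ be $3$-Lie algebras. A linear map $f\in\mathrm{Hom}(\mathfrak g,\mathfrak h)$ is a $3$-Lie algebra morphism if and only if $f$ is a Maurer-Cartan element of the $L_\infty$-algebra $(F,l_1,l_3)$, where $F=\bigoplus_{n\ge0}\mathrm{Hom}\big((\wedge^2\mathfrak g)^{\otimes n}\wedge\mathfrak g,\mathfrak h\big)$, $l_1(a_1)=[\pi,a_1]_{\mathsf R}$, $l_3(a_1,a_2,a_3)=[[[\mu,a_1]_{\mathsf R},a_2]_{\mathsf R},a_3]_{\mathsf R}$, and all other $l_k$ vanish.
   Context: All vector spaces are over a field of characteristic $0$. A $3$-Lie algebra is a vector space $\mathfrak g$ with a linear map $\pi:\wedge^3\mathfrak g\to\mathfrak g$ such that $\pi(x_1,x_2,\pi(x_3,x_4,x_5))=\pi(\pi(x_1,x_2,x_3),x_4,x_5)+\pi(x_3,\pi(x_1,x_2,x_4),x_5)+\pi(x_3,x_4,\pi(x_1,x_2,x_5))$ for all $x_i\in\mathfrak g$. A $3$-Lie algebra morphism $(\mathfrak g,\pi)\to(\mathfrak h,\mu)$ is a linear map $f$ with $f(\pi(x,y,z))=\mu(f(x),f(y),f(z))$ for all $x,y,z\in\mathfrak g$. Notation: for a vector space $V$, $(\wedge^2V)^{\otimes n}\wedge V$ means $V$ if $n=0$ and $(\wedge^2V)^{\otimes(n-1)}\otimes\wedge^3V$ if $n\ge1$. Put $C^n(V,V)=\mathrm{Hom}((\wedge^2V)^{\otimes n}\wedge V,V)$,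 in degree $n\ge0$. The space $\bigoplus_nC^n(V,V)$ is a graded Lie algebra with $[A,B]_{\mathsf R}=A\circ B-(-1)^{pq}B\circ A$ for $A\in C^p(V,V)$, $B\in C^q(V,V)$, where, for $\mathfrak X_i=x_i\wedge y_i\in\wedge^2V$, $x\in V$, $$\begin{aligned}(A\circ B)(\mathfrak X_1,\dots,\mathfrak X_{p+q},x)=&\sum_{k=1}^p(-1)^{(k-1)q}\sum_{\sigma\in\mathbb S(k-1,q)}(-1)^\sigma A\big(\mathfrak X_{\sigma(1)},\dots,\mathfrak X_{\sigma(k-1)},B(\mathfrak X_{\sigma(k)},\dots,\mathfrak X_{\sigma(k+q-1)},x_{k+q})\wedge y_{k+q},\mathfrak X_{k+q+1},\dots,\mathfrak X_{p+q},x\big)\\&+\sum_{k=1}^p(-1)^{(k-1)q}\sum_{\sigma\in\mathbb S(k-1,q)}(-1)^\sigma A\big(\mathfrak X_{\sigma(1)},\dots,\mathfrak X_{\sigma(k-1)},x_{k+q}\wedge B(\mathfrak X_{\sigma(k)},\dots,\mathfrak X_{\sigma(k+q-1)},y_{k+q}),\mathfrak X_{k+q+1},\dots,\mathfrak X_{p+q},x\big)\\&+\sum_{\sigma\in\mathbb S(p,q)}(-1)^{pq}(-1)^\sigma A\big(\mathfrak X_{\sigma(1)},\dots,\mathfrak X_{\sigma(p)},B(\mathfrak X_{\sigma(p+1)},\dots,\mathfrak X_{\sigma(p+q)},x)\big),\end{aligned}$$ with $\mathbb S(i,j)$ the set of $(i,j)$-shuffles. The brackets in the claim are taken in $\bigoplus_nC^n(\mathfrak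 g\oplus\mathfrak h,\mathfrak g\oplus\mathfrak h)$, where $Q\in\mathrm{Hom}((\wedge^2\mathfrak g)^{\otimes n}\wedge\mathfrak g,\mathfrak h)$ is identified with the map $((x_1,a_1)\wedge(y_1,b_1),\dots,(x_n,a_n)\wedge(y_n,b_n),(x,a))\mapsto(0,Q(x_1\wedge y_1,\dots,x_n\wedge y_n,x))$, and $\pi((x,a),(y,b),(z,c))=(\pi(x,y,z),0)$, $\mu((x,a),(y,b),(z,c))=(0,\mu(a,b,c))$. The maps $l_1,l_3$ take values in $F$, and $F$, graded by $n$, is with them an $L_\infty$-algebra (operations $l_k$ of degree $1$, graded symmetric, satisfying the generalized Jacobi identities). A Maurer-Cartan element of an $L_\infty$-algebra $(V,\{l_k\})$ (here with only finitely many nonzero $l_k$) is a degree $0$ element $\alpha\in V^0$ with $\sum_{k\ge1}\frac1{k!}l_k(\alpha,\dots,\alpha)=0$. *)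

theory Defs
  imports
    "HOL-Analysis.Product_Vector"
    "HOL-Combinatorics.Permutations"
    "HOL-Library.Function_Algebras"
begin

section \<open>3-Lie algebras\<close>

text \<open>A linear map out of the third exterior power is given by the corresponding
  alternating trilinear map.\<close>

locale three_lie_algebra = vector_space scale
  for scale :: "'k::field_char_0 \<Rightarrow> 'a::ab_group_add \<Rightarrow> 'a" +
  fixes br :: "'a \<Rightarrow> 'a \<Rightarrow> 'a \<Rightarrow> 'a"
  assumes linear_1: "Vector_Spaces.linear scale scale (\<lambda>x. br x y z)"
    and linear_2: "Vector_Spaces.linear scale scale (\<lambda>y. br x y z)"
    and linear_3: "Vector_Spaces.linear scale scale (\<lambda>z. br x y z)"
    and alternating: "br x x z = 0" "br x z x = 0" "br z x x = 0"
    and fundamental_identity: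
      "br x1 x2 (br x3 x4 x5) =
         br (br x1 x2 x3) x4 x5 + br x3 (br x1 x2 x4) x5 + br x3 x4 (br x1 x2 x5)"

definition three_lie_morphism ::
  "('k::field_char_0 \<Rightarrow> 'g::ab_group_add \<Rightarrow> 'g) \<Rightarrow> ('g \<Rightarrow> 'g \<Rightarrow> 'g \<Rightarrow> 'g) \<Rightarrow>
   ('k \<Rightarrow> 'h::ab_group_add \<Rightarrow> 'h) \<Rightarrow> ('h \<Rightarrow> 'h \<Rightarrow> 'h \<Rightarrow> 'h) \<Rightarrow> ('g \<Rightarrow> 'h) \<Rightarrow> bool" where
  "three_lie_morphism sg \<pi> sh \<mu> f \<longleftrightarrow>
     three_lie_algebra sg \<pi> \<and> three_lie_algebra sh \<mu> \<and> Vector_Spaces.linear sg sh f \<and>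
     (\<forall>x y z. f (\<pi> x y z) = \<mu> (f x) (f y) (f z))"


section \<open>Cochains\<close>

text \<open>The arguments \<open>x\<^sub>1 \<and> y\<^sub>1, \<dots>, x\<^sub>n \<and> y\<^sub>n, x\<close> of a cochain are passed as the list of the
  pairs \<open>(x\<^sub>i, y\<^sub>i)\<close> together with \<open>x\<close>.  A cochain of degree \<open>n\<close> is extended by zero to
  lists of other lengths, so that a function of this type may also have components in several
  degrees, and the cochains of all degrees live in one vector space with pointwise operations.\<close>

type_synonym ('v, 'w) cochain = "('v \<times> 'v) list \<Rightarrow> 'v \<Rightarrow> 'w"

definition cochain_scale :: "('k \<Rightarrow> 'w \<Rightarrow> 'w) \<Rightarrow> 'k \<Rightarrow> ('v, 'w) cochain \<Rightarrow> ('v, 'w) cochain" where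
  "cochain_scale s c A = (\<lambda>Xs x. s c (A Xs x))"

text \<open>\<open>wedge_hom sv sw n\<close> is the space of linear maps from \<open>(\<and>\<^sup>2V)\<^sup>\<otimes>\<^sup>n \<and> V\<close> to \<open>W\<close>, as maps that
  are linear in each of the \<open>2 n + 1\<close> vectors, alternating in every pair, and, since the last factor
  is \<open>\<and>\<^sup>3V\<close> for \<open>n \<ge> 1\<close>, alternating in the last three vectors.\<close>

definition wedge_hom ::
  "('k::field_char_0 \<Rightarrow> 'v::ab_group_add \<Rightarrow> 'v) \<Rightarrow> ('k \<Rightarrow> 'w::ab_group_add \<Rightarrow> 'w) \<Rightarrow> nat \<Rightarrow>
   ('v, 'w) cochain set" where
  "wedge_hom sv sw n = {A.
     (\<forall>Xs x. length Xs \<noteq> n \<longrightarrow> A Xs x = 0) \<and>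
     (\<forall>Xs. length Xs = n \<longrightarrow>
        Vector_Spaces.linear sv sw (A Xs) \<and>
        (\<forall>x. \<forall>i<n.
           Vector_Spaces.linear sv sw (\<lambda>u. A (Xs[i := (u, snd (Xs ! i))]) x) \<and>
           Vector_Spaces.linear sv sw (\<lambda>v. A (Xs[i := (fst (Xs ! i), v)]) x) \<and>
           (fst (Xs ! i) = snd (Xs ! i) \<longrightarrow> A Xs x = 0)) \<and>
        (\<forall>x. n \<ge> 1 \<and> (fst (Xs ! (n - 1)) = x \<or> snd (Xs ! (n - 1)) = x) \<longrightarrow> A Xs x = 0))}"

text \<open>\<open>(i,j)\<close>-shuffles, as permutations of \<open>{1..i+j}\<close>\<close>

definition shuffle_perms :: "nat \<Rightarrow> nat \<Rightarrow> (nat \<Rightarrow> nat) set" where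
  "shuffle_perms i j =
     {\<sigma>. \<sigma> permutes {1..i+j} \<and> strict_mono_on {1..i} \<sigma> \<and> strict_mono_on {i+1..i+j} \<sigma>}"

text \<open>The product of the degree \<open>p\<close> component of \<open>A\<close> with the degree \<open>q\<close> component of \<open>B\<close>\<close>

definition rota_circ ::
  "('k::field_char_0 \<Rightarrow> 'v::ab_group_add \<Rightarrow> 'v) \<Rightarrow> nat \<Rightarrow> nat \<Rightarrow>
   ('v, 'v) cochain \<Rightarrow> ('v, 'v) cochain \<Rightarrow> ('v, 'v) cochain" where
  "rota_circ s p q A B Xs x =
    (if length Xs \<noteq> p + q then 0 else
     let X = (\<lambda>i. Xs ! (i - 1)) in
       (\<Sum>k=1..p. s ((-1) ^ ((k - 1) * q))
          (\<Sum>\<sigma>\<in>shuffle_perms (k - 1) q. s (of_int (sign \<sigma>))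
             (A (map (\<lambda>i. X (\<sigma> i)) [1..<k]
                 @ [(B (map (\<lambda>i. X (\<sigma> i)) [k..<k+q]) (fst (X (k + q))), snd (X (k + q)))]
                 @ map X [k+q+1..<p+q+1]) x)))
     + (\<Sum>k=1..p. s ((-1) ^ ((k - 1) * q))
          (\<Sum>\<sigma>\<in>shuffle_perms (k - 1) q. s (of_int (sign \<sigma>))
             (A (map (\<lambda>i. X (\<sigma> i)) [1..<k]
                 @ [(fst (X (k + q)), B (map (\<lambda>i. X (\<sigma> i)) [k..<k+q]) (snd (X (k + q))))]
                 @ map X [k+q+1..<p+q+1]) x)))
     + (\<Sum>\<sigma>\<in>shuffle_perms p q. s ((-1) ^ (p * q)) (s (of_int (sign \<sigma>))
          (A (map (\<lambda>i. X (\<sigma> i)) [1..<p+1])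
             (B (map (\<lambda>i. X (\<sigma> i)) [p+1..<p+q+1]) x)))))"

text \<open>The bracket is the bilinear extension of
  \<open>[A, B] = A \<circ> B - (-1)\<^sup>p\<^sup>q B \<circ> A\<close> for \<open>A\<close> of degree \<open>p\<close> and \<open>B\<close> of degree \<open>q\<close>.  On a list of
  length \<open>m\<close> only the degrees with \<open>p + q = m\<close> contribute.\<close>

definition rota_bracket ::
  "('k::field_char_0 \<Rightarrow> 'v::ab_group_add \<Rightarrow> 'v) \<Rightarrow>
   ('v, 'v) cochain \<Rightarrow> ('v, 'v) cochain \<Rightarrow> ('v, 'v) cochain" where
  "rota_bracket s A B Xs x =
     (\<Sum>(p, q) \<in> {(p, q). p + q = length Xs}.
        rota_circ s p q A B Xs x - s ((-1) ^ (p * q)) (rota_circ s q p B A Xs x))"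


section \<open>$L_\infty$-algebras and Maurer-Cartan elements\<close>

text \<open>Koszul sign of the permutation \<open>\<sigma>\<close> of \<open>n\<close> elements of degrees \<open>d 1, \<dots>, d n\<close>\<close>

definition koszul_sign :: "nat \<Rightarrow> (nat \<Rightarrow> int) \<Rightarrow> (nat \<Rightarrow> nat) \<Rightarrow> 'k::field" where
  "koszul_sign n d \<sigma> =
     (\<Prod>(i, j) \<in> {(i, j). 1 \<le> i \<and> i < j \<and> j \<le> n \<and> \<sigma> j < \<sigma> i}. (-1) powi (d (\<sigma> i) * d (\<sigma> j)))"

text \<open>The operation \<open>l\<^sub>k\<close> is \<open>l\<close> on lists of length \<open>k \<ge> 1\<close>; the value on the empty list is not
  used.  \<open>V d\<close> is the subspace of elements of degree \<open>d\<close>.\<close>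

locale linfty_data =
  fixes scale :: "'k::field_char_0 \<Rightarrow> 'e::ab_group_add \<Rightarrow> 'e"
    and V :: "int \<Rightarrow> 'e set"
    and l :: "'e list \<Rightarrow> 'e"
begin

text \<open>The Maurer-Cartan equation involves only the graded space and the operations.\<close>

definition maurer_cartan :: "'e \<Rightarrow> bool" where
  "maurer_cartan \<alpha> \<longleftrightarrow> \<alpha> \<in> V 0 \<and>
     (let K = {k. k \<ge> 1 \<and> l (replicate k \<alpha>) \<noteq> 0} in
      finite K \<and> (\<Sum>k\<in>K. scale (1 / fact k) (l (replicate k \<alpha>))) = 0)"

definition homogeneous :: "'e list \<Rightarrow> int list \<Rightarrow> bool" where
  "homogeneous xs ds \<longleftrightarrow> list_all2 (\<lambda>x d. x \<in> V d) xs ds"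

end

locale linfty_algebra = linfty_data scale V l + vector_space scale
  for scale :: "'k::field_char_0 \<Rightarrow> 'e::ab_group_add \<Rightarrow> 'e"
    and V :: "int \<Rightarrow> 'e set"
    and l :: "'e list \<Rightarrow> 'e" +
  assumes subspace_V: "subspace (V d)"
    and direct_sum: "\<lbrakk>finite D; \<And>d. d \<in> D \<Longrightarrow> v d \<in> V d; (\<Sum>d\<in>D. v d) = 0; d \<in> D\<rbrakk> \<Longrightarrow> v d = 0"
    and degree_one: "\<lbrakk>xs \<noteq> []; homogeneous xs ds\<rbrakk> \<Longrightarrow> l xs \<in> V (sum_list ds + 1)"
    and add_arg: "\<lbrakk>homogeneous (xs @ x # ys) ds; homogeneous (xs @ x' # ys) ds\<rbrakk> \<Longrightarrow>
      l (xs @ (x + x') # ys) = l (xs @ x # ys) + l (xs @ x' # ys)"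
    and scale_arg: "homogeneous (xs @ x # ys) ds \<Longrightarrow>
      l (xs @ scale c x # ys) = scale c (l (xs @ x # ys))"
    and graded_symmetric:
      "\<lbrakk>homogeneous xs ds; x \<in> V d; y \<in> V e; homogeneous ys es\<rbrakk> \<Longrightarrow>
        l (xs @ [x, y] @ ys) = scale ((-1) powi (d * e)) (l (xs @ [y, x] @ ys))"
    and generalized_jacobi:
      "\<lbrakk>n \<ge> 1; length xs = n; homogeneous xs ds\<rbrakk> \<Longrightarrow>
        (\<Sum>i=1..n. \<Sum>\<sigma>\<in>shuffle_perms i (n - i).
           scale (koszul_sign n (\<lambda>j. ds ! (j - 1)) \<sigma>)
             (l (l (map (\<lambda>j. xs ! (\<sigma> j - 1)) [1..<i+1])
                 # map (\<lambda>j. xs ! (\<sigma> j - 1)) [i+1..<n+1]))) = 0"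


section \<open>The $L_\infty$-algebra of a pair of 3-Lie algebras\<close>

text \<open>Identification of cochains on \<open>\<gg>\<close> with values in \<open>\<hh>\<close> with cochains on \<open>\<gg> \<oplus> \<hh>\<close>\<close>

definition incl :: "('g, 'h) cochain \<Rightarrow> ('g \<times> 'h, 'g::zero \<times> 'h) cochain" where
  "incl Q Xs z = (0, Q (map (map_prod fst fst) Xs) (fst z))"

definition cochain_0 :: "('v \<Rightarrow> 'w::zero) \<Rightarrow> ('v, 'w) cochain" where
  "cochain_0 f Xs x = (if Xs = [] then f x else 0)"

definition cochain_1 :: "('v \<Rightarrow> 'v \<Rightarrow> 'v \<Rightarrow> 'w::zero) \<Rightarrow> ('v, 'w) cochain" where
  "cochain_1 b Xs x = (case Xs of [(u, v)] \<Rightarrow> b u v x | _ \<Rightarrow> 0)"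

definition lift_fst ::
  "('g \<Rightarrow> 'g \<Rightarrow> 'g \<Rightarrow> 'g::zero) \<Rightarrow> ('g \<times> 'h, 'g \<times> 'h::zero) cochain" where
  "lift_fst \<pi> = cochain_1 (\<lambda>u v w. (\<pi> (fst u) (fst v) (fst w), 0))"

definition lift_snd ::
  "('h \<Rightarrow> 'h \<Rightarrow> 'h \<Rightarrow> 'h::zero) \<Rightarrow> ('g \<times> 'h, 'g::zero \<times> 'h) cochain" where
  "lift_snd \<mu> = cochain_1 (\<lambda>u v w. (0, \<mu> (snd u) (snd v) (snd w)))"

definition F_space ::
  "('k::field_char_0 \<Rightarrow> 'g::ab_group_add \<Rightarrow> 'g) \<Rightarrow> ('k \<Rightarrow> 'h::ab_group_add \<Rightarrow> 'h) \<Rightarrow>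
   int \<Rightarrow> ('g \<times> 'h, 'g \<times> 'h) cochain set" where
  "F_space sg sh d = (if d < 0 then {0} else incl ` wedge_hom sg sh (nat d))"

definition F_scale ::
  "('k::field_char_0 \<Rightarrow> 'g::ab_group_add \<Rightarrow> 'g) \<Rightarrow> ('k \<Rightarrow> 'h::ab_group_add \<Rightarrow> 'h) \<Rightarrow>
   'k \<Rightarrow> ('g \<times> 'h, 'g \<times> 'h) cochain \<Rightarrow> ('g \<times> 'h, 'g \<times> 'h) cochain" where
  "F_scale sg sh = cochain_scale (module_prod.scale sg sh)"

definition F_bracket ::
  "('k::field_char_0 \<Rightarrow> 'g::ab_group_add \<Rightarrow> 'g) \<Rightarrow> ('k \<Rightarrow> 'h::ab_group_add \<Rightarrow> 'h) \<Rightarrow>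
   ('g \<times> 'h, 'g \<times> 'h) cochain \<Rightarrow> ('g \<times> 'h, 'g \<times> 'h) cochain \<Rightarrow> ('g \<times> 'h, 'g \<times> 'h) cochain" where
  "F_bracket sg sh = rota_bracket (module_prod.scale sg sh)"

definition F_ops ::
  "('k::field_char_0 \<Rightarrow> 'g::ab_group_add \<Rightarrow> 'g) \<Rightarrow> ('g \<Rightarrow> 'g \<Rightarrow> 'g \<Rightarrow> 'g) \<Rightarrow>
   ('k \<Rightarrow> 'h::ab_group_add \<Rightarrow> 'h) \<Rightarrow> ('h \<Rightarrow> 'h \<Rightarrow> 'h \<Rightarrow> 'h) \<Rightarrow>
   ('g \<times> 'h, 'g \<times> 'h) cochain list \<Rightarrow> ('g \<times> 'h, 'g \<times> 'h) cochain" where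
  "F_ops sg \<pi> sh \<mu> as = (case as of
       [a1] \<Rightarrow> F_bracket sg sh (lift_fst \<pi>) a1
     | [a1, a2, a3] \<Rightarrow>
         F_bracket sg sh (F_bracket sg sh (F_bracket sg sh (lift_snd \<mu>) a1) a2) a3
     | _ \<Rightarrow> 0)"

end

theory Submission
  imports Defs
begin

text \<open>The bracket of the trilinear map \<open>b\<close> with a linear map \<open>f\<close> is the defect of \<open>f\<close> from being a
  derivation of \<open>b\<close>. On \<open>\<gg> \<oplus> \<hh>\<close> the map \<open>f\<close> squares to zero, kills \<open>\<hh>\<close> and takes values in \<open>\<hh>\<close>.
  Hence \<open>[\<pi>, f]\<close> reduces to \<open>- f \<circ> \<pi>\<close>, and in the triple bracket of \<open>\<mu>\<close> with \<open>f\<close> only the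
  \<open>3!\<close> terms survive in which \<open>f\<close> enters each argument of \<open>\<mu>\<close> once. The Maurer-Cartan equation
  is therefore \<open>- f (\<pi> x y z) + \<mu> (f x) (f y) (f z) = 0\<close>.\<close>

text \<open>A strictly increasing permutation \<sigma> of {1..n} satisfies i \<le> \<sigma> i by
  induction, which forces it to be the identity. As f has degree 0, every shuffle sum needed below
  thus has one term.\<close>

lemma shuffle_perms_0_right: "shuffle_perms n 0 = {id}"
proof -
  have "\<sigma> = id" if p: "\<sigma> permutes {1..n}" and m: "strict_mono_on {1..n} \<sigma>" for \<sigma>
  proof -
    have inv: "\<sigma> i \<in> {1..n}" if "i \<in> {1..n}" for i
      using p that by (simp only: permutes_in_image)
    have le: "i \<le> n \<Longrightarrow> 1 \<le> i \<Longrightarrow> i \<le> \<sigma> i" for i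
    proof (induction i)
      case (Suc i)
      show ?case
      proof (cases "i = 0")
        case True
        then show ?thesis using inv[of "Suc i"] Suc.prems by auto
      next
        case False
        then have "i \<le> \<sigma> i" "\<sigma> i < \<sigma> (Suc i)"
          using Suc m by (auto simp: strict_mono_on_def)
        then show ?thesis by simp
      qed
    qed simp
    show ?thesis
      by (metis le p permutes_natset_ge atLeastAtMost_iff)
  qed
  then show ?thesis
    by (auto simp: shuffle_perms_def permutes_id strict_mono_on_def)
qed

lemma shuffle_perms_0_left: "shuffle_perms 0 n = {id}"
  using shuffle_perms_0_right[of n] by (auto simp: shuffle_perms_def)

lemma cochain_1_eq_0: "length Xs \<noteq> 1 \<Longrightarrow> cochain_1 b Xs x = 0"
  by (auto simp: cochain_1_def split: list.splits)

text \<open>Only the degrees (1, 0) contribute. For any other pair some cochain meets a list of the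
  wrong length and gives zero; this is either the outer value or a zero vector put into
  \<open>b\<close> or \<open>f\<close>, hence \<open>b0\<close> and \<open>f0\<close>. The result is
  again a \<open>cochain_1\<close>, so the lemma can be iterated.\<close>

lemma rota_bracket_cochain_1_cochain_0:
  assumes "vector_space s"
    and b0: "\<And>v w. b 0 v w = 0" "\<And>u w. b u 0 w = 0" "\<And>u v. b u v 0 = 0"
    and f0: "f 0 = 0"
  shows "rota_bracket s (cochain_1 b) (cochain_0 f) =
    cochain_1 (\<lambda>u v w. b (f u) v w + b u (f v) w + b u v (f w) - f (b u v w))"
    (is "rota_bracket s ?A ?B = _")
proof (intro ext)
  interpret vector_space s by fact
  fix Xs x
  have AB: "rota_circ s p q ?A ?B Xs x = 0" if "p \<noteq> 1 \<or> q \<noteq> 0" for p q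
  proof (cases "p = 1")
    case True
    with that have "q > 0" by simp
    then show ?thesis
      using b0 True by (simp add: rota_circ_def cochain_1_def cochain_0_def sum.neutral)
  next
    case False
    then show ?thesis
      by (auto simp: rota_circ_def cochain_1_eq_0 intro!: sum.neutral)
  qed
  have BA: "rota_circ s q p ?B ?A Xs x = 0" if "p \<noteq> 1 \<or> q \<noteq> 0" for p q
  proof (cases "q = 0")
    case True
    with that have "p \<noteq> 1" by simp
    then show ?thesis
      using f0 True by (simp add: rota_circ_def cochain_1_eq_0 cochain_0_def)
  next
    case False
    then show ?thesis
      by (auto simp: rota_circ_def cochain_0_def intro!: sum.neutral)
  qed
  have summand: "(case c of (p, q) \<Rightarrow>
      rota_circ s p q ?A ?B Xs x - s ((-1) ^ (p * q)) (rota_circ s q p ?B ?A Xs x)) = 0"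
    if "c \<noteq> (1, 0)" for c
  proof -
    obtain p q where c: "c = (p, q)" by fastforce
    with that have pq: "p \<noteq> 1 \<or> q \<noteq> 0" by simp
    show ?thesis
      by (simp only: c AB[OF pq] BA[OF pq] prod.case scale_zero_right diff_0_right)
  qed
  have fin: "finite {(p, q). p + q = length Xs}"
    by (rule finite_subset[of _ "{..length Xs} \<times> {..length Xs}"]) auto
  show "rota_bracket s ?A ?B Xs x =
    cochain_1 (\<lambda>u v w. b (f u) v w + b u (f v) w + b u v (f w) - f (b u v w)) Xs x"
  proof (cases "length Xs = 1")
    case True
    then obtain u v where Xs: "Xs = [(u, v)]"
      by (cases Xs) auto
    have "rota_bracket s ?A ?B Xs x =
        (\<Sum>(p, q)\<in>{(1, 0)}. rota_circ s p q ?A ?B Xs x - s ((-1) ^ (p * q)) (rota_circ s q p ?B ?A Xs x))"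
      unfolding rota_bracket_def using True
      by (intro sum.mono_neutral_right fin ballI summand) auto
    \<comment> \<open>Since q = 0 all signs are 1. The first three terms come from \<open>?A\<close>
      composed with \<open>?B\<close>, the subtracted one from the opposite composition.\<close>
    also have "\<dots> = b (f u) v x + b u (f v) x + b u v (f x) - f (b u v x)"
      by (simp add: Xs rota_circ_def shuffle_perms_0_left shuffle_perms_0_right
          cochain_1_def cochain_0_def)
    finally show ?thesis by (simp add: Xs cochain_1_def)
  next
    case False
    show ?thesis
      unfolding rota_bracket_def cochain_1_eq_0[OF False]
      using False by (intro sum.neutral ballI summand) auto
  qed
qed

lemma incl_cochain_0: "incl (cochain_0 f) = cochain_0 (\<lambda>z. (0, f (fst z)))"
  by (auto simp: fun_eq_iff incl_def cochain_0_def zero_prod_def)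

lemma cochain_1_eq_zero_iff: "cochain_1 b = 0 \<longleftrightarrow> (\<forall>u v w. b u v w = 0)"
proof
  assume "cochain_1 b = 0"
  then have "cochain_1 b [(u, v)] w = 0" for u v w by simp
  then show "\<forall>u v w. b u v w = 0" by (simp add: cochain_1_def)
qed (auto simp: cochain_1_def fun_eq_iff split: list.splits)

lemma three_lie_algebra_zero:
  assumes "three_lie_algebra s b"
  shows "b 0 y z = 0" "b x 0 z = 0" "b x y 0 = 0"
proof -
  interpret three_lie_algebra s b by fact
  show "b 0 y z = 0" "b x 0 z = 0" "b x y 0 = 0"
    using linear_1[of y z] linear_2[of x z] linear_3[of x y]
    unfolding linear_iff_module_hom by (auto dest: module_hom.zero)
qed

theorem theorem2p12:
  fixes sg :: "'k::field_char_0 \<Rightarrow> 'g::ab_group_add \<Rightarrow> 'g"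
    and sh :: "'k \<Rightarrow> 'h::ab_group_add \<Rightarrow> 'h"
    and \<pi> :: "'g \<Rightarrow> 'g \<Rightarrow> 'g \<Rightarrow> 'g"
    and \<mu> :: "'h \<Rightarrow> 'h \<Rightarrow> 'h \<Rightarrow> 'h"
    and f :: "'g \<Rightarrow> 'h"
  assumes "three_lie_algebra sg \<pi>"
    and "three_lie_algebra sh \<mu>"
    and "Vector_Spaces.linear sg sh f"
  shows "three_lie_morphism sg \<pi> sh \<mu> f \<longleftrightarrow>
    linfty_data.maurer_cartan (F_scale sg sh) (F_space sg sh) (F_ops sg \<pi> sh \<mu>)
      (incl (cochain_0 f))"
proof -
  interpret G: three_lie_algebra sg \<pi> by fact
  interpret H: three_lie_algebra sh \<mu> by fact
  interpret f: Vector_Spaces.linear sg sh f by fact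
  interpret P: vector_space_prod sg sh ..
  note [simp] = three_lie_algebra_zero[OF assms(1)] three_lie_algebra_zero[OF assms(2)] f.zero
  let ?s = "module_prod.scale sg sh"
  let ?f = "\<lambda>z :: 'g \<times> 'h. (0 :: 'g, f (fst z))"
  let ?\<alpha> = "incl (cochain_0 f) :: ('g \<times> 'h, 'g \<times> 'h) cochain"
  let ?l = "F_ops sg \<pi> sh \<mu>"
  have vs: "vector_space ?s" by (rule P.p.vector_space_axioms)
  have l1: "?l [?\<alpha>] = cochain_1 (\<lambda>u v w. (0, - f (\<pi> (fst u) (fst v) (fst w))))"
    unfolding F_ops_def F_bracket_def lift_fst_def incl_cochain_0
    by (simp add: rota_bracket_cochain_1_cochain_0[OF vs] zero_prod_def)
  have m1: "rota_bracket ?s (lift_snd \<mu>) ?\<alpha> =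
    cochain_1 (\<lambda>u v w. (0, \<mu> (f (fst u)) (snd v) (snd w) + \<mu> (snd u) (f (fst v)) (snd w)
      + \<mu> (snd u) (snd v) (f (fst w))))"
    unfolding lift_snd_def incl_cochain_0
    by (simp add: rota_bracket_cochain_1_cochain_0[OF vs] zero_prod_def)
  \<comment> \<open>Two applications of \<open>?f\<close> in one slot give \<open>f 0 = 0\<close>,
    so they occupy different slots, and each pair of slots is filled in two orders.\<close>
  have m2: "rota_bracket ?s (rota_bracket ?s (lift_snd \<mu>) ?\<alpha>) ?\<alpha> =
    cochain_1 (\<lambda>u v w. let x = f (fst u); y = f (fst v); z = f (fst w) in
      (0, \<mu> x y (snd w) + \<mu> x y (snd w) + (\<mu> x (snd v) z + \<mu> x (snd v) z)
        + (\<mu> (snd u) y z + \<mu> (snd u) y z)))"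
    unfolding m1 unfolding incl_cochain_0
    by (simp add: rota_bracket_cochain_1_cochain_0[OF vs] zero_prod_def Let_def algebra_simps)
  have l3: "?l [?\<alpha>, ?\<alpha>, ?\<alpha>] =
    cochain_1 (\<lambda>u v w. (0, sh 6 (\<mu> (f (fst u)) (f (fst v)) (f (fst w)))))"
  proof -
    \<comment> \<open>The factor 6 is the 3! of the Maurer-Cartan equation and will cancel against
      \<open>1 / fact 3\<close>. The brackets produce it as six separate summands.\<close>
    have six: "sh 6 a = a + a + a + a + a + a" for a
    proof -
      have "sh 6 a = sh (1 + 1 + 1 + 1 + 1 + 1) a" by simp
      then show ?thesis by (simp only: H.scale_left_distrib H.scale_one)
    qed
    have "?l [?\<alpha>, ?\<alpha>, ?\<alpha>] =
        rota_bracket ?s (rota_bracket ?s (rota_bracket ?s (lift_snd \<mu>) ?\<alpha>) ?\<alpha>) ?\<alpha>"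
      by (simp add: F_ops_def F_bracket_def)
    then show ?thesis
      unfolding m2 unfolding incl_cochain_0
      by (simp add: rota_bracket_cochain_1_cochain_0[OF vs] zero_prod_def Let_def six algebra_simps)
  qed
  let ?K = "{k. k \<ge> 1 \<and> ?l (replicate k ?\<alpha>) \<noteq> 0}"
  let ?t = "\<lambda>k. F_scale sg sh (1 / fact k) (?l (replicate k ?\<alpha>))"
  have K: "?K \<subseteq> {1, 3}"
  proof
    fix k assume "k \<in> ?K"
    moreover have "?l (replicate k ?\<alpha>) = 0" if "k \<notin> {1, 3}"
      using that
      \<comment> \<open>Comparing lengths turns a match of \<open>replicate k ?\<alpha>\<close> with
        a one- or three-element list into k = 1 or k = 3.\<close>
      by (auto simp: F_ops_def zero_fun_def split: list.splits dest!: arg_cong[of _ _ length])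
    ultimately show "k \<in> {1, 3}" by blast
  qed
  \<comment> \<open>\<open>?K\<close> lacks 1 or 3 if that operation happens to vanish at
    \<open>?\<alpha>\<close>; the added terms are then zero.\<close>
  have "sum ?t ?K = sum ?t {1, 3}"
    using K by (intro sum.mono_neutral_left)
      (auto simp: F_scale_def cochain_scale_def P.p.scale_zero_right zero_fun_def)
  also have "\<dots> = ?t 1 + ?t 3" by simp
  also have "\<dots> = cochain_1 (\<lambda>u v w. (0, \<mu> (f (fst u)) (f (fst v)) (f (fst w))
      - f (\<pi> (fst u) (fst v) (fst w))))"
    using l1 l3
    by (auto simp: fun_eq_iff numeral_3_eq_3 F_scale_def cochain_scale_def cochain_1_def
        P.scale_def zero_prod_def split: list.splits)
  finally have sum: "sum ?t ?K = \<dots>" .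
  have mem: "?\<alpha> \<in> F_space sg sh 0"
  proof -
    have "cochain_0 f [] = f" by (simp add: fun_eq_iff cochain_0_def)
    then have "cochain_0 f \<in> wedge_hom sg sh 0"
      using assms(3) by (simp add: wedge_hom_def cochain_0_def)
    then show ?thesis by (simp add: F_space_def)
  qed
  have "linfty_data.maurer_cartan (F_scale sg sh) (F_space sg sh) ?l ?\<alpha> \<longleftrightarrow> sum ?t ?K = 0"
    using mem finite_subset[OF K] by (simp add: linfty_data.maurer_cartan_def Let_def)
  \<comment> \<open>Only the first components of the arguments enter \<open>sum\<close>, so the
    condition on pairs becomes one on elements of the first algebra.\<close>
  also have "\<dots> \<longleftrightarrow> (\<forall>x y z. f (\<pi> x y z) = \<mu> (f x) (f y) (f z))"
    unfolding sum by (simp add: cochain_1_eq_zero_iff zero_prod_def) metis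
  finally show ?thesis
    using assms by (simp add: three_lie_morphism_def)
qed

end
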